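(* Let $F$ be a field of characteristic zero equipped with an automorphism $\sigma$ and a derivation $\partial$ such that $\sigma\partial=\partial\sigma$, and suppose that $K=F^\sigma$ is algebraically closed. Let $a_1,\dots,a_n\in F$ and let $S$ be a $(\sigma,\partial)$-extension of $F$ such that $S^\sigma=K$. If $z_1,\dots,z_n\in S$ satisfy $\sigma(z_i)-z_i=a_i$ for $i=1,\dots,n$, then $z_1,\dots,z_n$ satisfy a nontrivial $\partial$-relation over $F$ if and only if there exist a nonzero homogeneous linear differential polynomial $L(Y_1,\dots,Y_n)$ with coefficients in $K$ and an element $f\in F$ such that $L(a_1,\dots,a_n)=\sigma(f)-f$.
   Context: For a ring $R$ with an action of $\sigma$, $R^\sigma$ denotes the set of $\sigma$-invariant elements. A $(\sigma,\partial)$-extension of $F$ is a (commutative) ring extension equipped with extensions of $\sigma$ and $\partial$ that still commute. A nontrivial $\partial$-relation over $F$ is a nonzero differential polynomial in $F\{Y_1,\dots,Y_n\}_\partial$ vanishing at $(z_1,\dots,z_n)$. A homogeneous linear differential polynomial is an expression $\sum_{i=1}^n\sum_{j}c_{i,j}\partial^j(Y_i)$ (finite sum). *)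

theory Defs
  imports
    "HOL-Computational_Algebra.Polynomial"
    "HOL-Library.Poly_Mapping"
    "Subresultants.More_Homomorphisms"
begin

locale derivation =
  fixes D :: "'a::comm_ring_1 \<Rightarrow> 'a"
  assumes D_add: "D (x + y) = D x + D y"
    and D_mult: "D (x * y) = D x * y + x * D y"

text \<open>
  Here \<open>\<sigma>\<close> is only required to be a ring endomorphism; bijectivity of \<open>\<sigma>\<close> is stated
  separately where it is wanted.
\<close>

locale sigma_delta_ring = comm_ring_hom \<sigma> + derivation \<delta>
  for \<sigma> \<delta> :: "'a::comm_ring_1 \<Rightarrow> 'a" +
  assumes commute: "\<sigma> (\<delta> x) = \<delta> (\<sigma> x)"

text \<open>A ring extension is given by an injective ring homomorphism \<open>\<iota>\<close>.\<close>

locale sigma_delta_extension =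
  base: sigma_delta_ring \<sigma> \<delta> +
  ext: sigma_delta_ring \<sigma>' \<delta>' +
  inj_comm_ring_hom \<iota>
  for \<sigma> \<delta> :: "'a::comm_ring_1 \<Rightarrow> 'a"
    and \<sigma>' \<delta>' :: "'b::comm_ring_1 \<Rightarrow> 'b"
    and \<iota> :: "'a \<Rightarrow> 'b" +
  assumes sigma_extends: "\<sigma>' (\<iota> x) = \<iota> (\<sigma> x)"
    and delta_extends: "\<delta>' (\<iota> x) = \<iota> (\<delta> x)"

definition invariants :: "('a \<Rightarrow> 'a) \<Rightarrow> 'a set"
  where "invariants \<sigma> = {x. \<sigma> x = x}"

text \<open>To be applied to a subset \<open>K\<close> that is a subfield.\<close>

definition algebraically_closed_subfield :: "'a::field set \<Rightarrow> bool"
  where "algebraically_closed_subfield K \<longleftrightarrow>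
    (\<forall>p. (\<forall>i. coeff p i \<in> K) \<and> degree p > 0 \<longrightarrow> (\<exists>x\<in>K. poly p x = 0))"

text \<open>
  Differential polynomials are polynomials in the indeterminates \<open>(i, j)\<close>, where \<open>(i, j)\<close>
  stands for the \<open>j\<close>-th derivative of \<open>Y\<^sub>i\<close>. A monomial is the finitely supported function
  giving the exponent of every indeterminate, and a differential polynomial is the finitely
  supported function giving the coefficient of every monomial.
\<close>

type_synonym 'a dpoly = "((nat \<times> nat) \<Rightarrow>\<^sub>0 nat) \<Rightarrow>\<^sub>0 'a"

text \<open>The ring of differential polynomials in \<open>Y\<^sub>1, \<dots>, Y\<^sub>n\<close>.\<close>

definition dpolys :: "nat \<Rightarrow> 'a::comm_ring_1 dpoly set"
  where "dpolys n = {P. \<forall>m\<in>Poly_Mapping.keys P. fst ` Poly_Mapping.keys m \<subseteq> {1..n}}"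

text \<open>
  The value of a differential polynomial at \<open>z\<close>, with coefficients mapped along \<open>h\<close>: the
  indeterminate \<open>(i, j)\<close> is replaced by the \<open>j\<close>-th iterated derivative of \<open>z i\<close>.
\<close>

definition eval_dpoly ::
    "('a::comm_ring_1 \<Rightarrow> 'b::comm_ring_1) \<Rightarrow> ('b \<Rightarrow> 'b) \<Rightarrow> (nat \<Rightarrow> 'b) \<Rightarrow> 'a dpoly \<Rightarrow> 'b"
  where "eval_dpoly h D z P =
    (\<Sum>m\<in>Poly_Mapping.keys P. h (Poly_Mapping.lookup P m) *
      (\<Prod>(i, j)\<in>Poly_Mapping.keys m. ((D ^^ j) (z i)) ^ Poly_Mapping.lookup m (i, j)))"

definition dvar :: "nat \<Rightarrow> nat \<Rightarrow> (nat \<times> nat) \<Rightarrow>\<^sub>0 nat"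
  where "dvar i j = Poly_Mapping.single (i, j) 1"

definition homogeneous_linear_dpolys :: "nat \<Rightarrow> 'a::comm_ring_1 set \<Rightarrow> 'a dpoly set"
  where "homogeneous_linear_dpolys n K =
    {L. \<exists>r c. (\<forall>i\<in>{1..n}. \<forall>j\<le>r. c i j \<in> K) \<and>
        L = (\<Sum>i=1..n. \<Sum>j\<le>r. Poly_Mapping.single (dvar i j) (c i j))}"

definition satisfies_nontrivial_relation ::
    "('a::comm_ring_1 \<Rightarrow> 'b::comm_ring_1) \<Rightarrow> ('b \<Rightarrow> 'b) \<Rightarrow> nat \<Rightarrow> (nat \<Rightarrow> 'b) \<Rightarrow> bool"
  where "satisfies_nontrivial_relation h D n z \<longleftrightarrow>
    (\<exists>P\<in>dpolys n. P \<noteq> 0 \<and> eval_dpoly h D z P = 0)"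

end

theory Submission
  imports Defs
begin

text \<open>
  Let \<open>P\<close> be a relation between elements \<open>w\<^sub>v\<close> with \<open>\<sigma>(w\<^sub>v) = w\<^sub>v + b\<^sub>v\<close>, of minimal degree \<open>d\<close>, with as
  few monomials of degree \<open>d\<close> as possible, one of them having coefficient \<open>1\<close>. Then \<open>P\<^sup>\<sigma>(Y + b)\<close> is
  also a relation, and \<open>P\<^sup>\<sigma>(Y + b) - P\<close> is smaller than \<open>P\<close>, hence zero. So the coefficients in degree
  \<open>d\<close> are invariant, and comparing those of a monomial \<open>x\<close> of degree \<open>d - 1\<close> gives
  \<open>p\<^sub>x = \<sigma>(p\<^sub>x) + \<Sum>\<^sub>v b\<^sub>v c\<^sub>v\<close>, where \<open>c\<^sub>v\<close> is the (invariant) coefficient of \<open>x\<close> in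
  \<open>\<partial>P/\<partial>Y\<^sub>v\<close>. In characteristic zero some choice of \<open>x\<close> makes the \<open>c\<^sub>v\<close> not all zero.

  Conversely, if \<open>L(a) = \<sigma>(f) - f\<close>, then \<open>L(z) - f\<close> is invariant, hence lies in \<open>K\<close>.
\<close>

section \<open>Polynomials as finitely supported functions\<close>

abbreviation (input) lkp :: "('a \<Rightarrow>\<^sub>0 'b::zero) \<Rightarrow> 'a \<Rightarrow> 'b"
  where "lkp \<equiv> Poly_Mapping.lookup"

abbreviation (input) sgl :: "'a \<Rightarrow> 'b \<Rightarrow> ('a \<Rightarrow>\<^sub>0 'b::zero)"
  where "sgl \<equiv> Poly_Mapping.single"

section \<open>Total degree and evaluation for an arbitrary type of variables\<close>

definition mdegree :: "('v \<Rightarrow>\<^sub>0 nat) \<Rightarrow> nat"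
  where "mdegree m = (\<Sum>v\<in>Poly_Mapping.keys m. lkp m v)"

definition eval_monom :: "('v \<Rightarrow> 's::comm_ring_1) \<Rightarrow> ('v \<Rightarrow>\<^sub>0 nat) \<Rightarrow> 's"
  where "eval_monom w m = (\<Prod>v\<in>Poly_Mapping.keys m. w v ^ lkp m v)"

definition eval_mpoly ::
    "('f::comm_ring_1 \<Rightarrow> 's::comm_ring_1) \<Rightarrow> ('v \<Rightarrow> 's) \<Rightarrow> (('v \<Rightarrow>\<^sub>0 nat) \<Rightarrow>\<^sub>0 'f) \<Rightarrow> 's"
  where "eval_mpoly h w P = (\<Sum>m\<in>Poly_Mapping.keys P. h (lkp P m) * eval_monom w m)"

lemma mdegree_0 [simp]: "mdegree 0 = 0"
  by (simp add: mdegree_def)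

lemma mdegree_single [simp]: "mdegree (sgl v k) = k"
  by (simp add: mdegree_def)

lemma mdegree_add [simp]: "mdegree (m + m') = mdegree m + mdegree m'"
  unfolding mdegree_def by (rule setsum_keys_plus_distrib) auto

lemma mdegree_eq_0_iff [simp]: "mdegree m = 0 \<longleftrightarrow> m = 0"
proof
  assume "mdegree m = 0"
  then show "m = 0"
    by (intro poly_mapping_eqI) (auto simp: mdegree_def in_keys_iff)
qed simp

lemma eval_monom_0 [simp]: "eval_monom w 0 = 1"
  by (simp add: eval_monom_def)

lemma eval_monom_single [simp]: "eval_monom w (sgl v 1) = w v"
  by (simp add: eval_monom_def)

lemma eval_monom_superset:
  assumes "finite A" "Poly_Mapping.keys m \<subseteq> A"
  shows "eval_monom w m = (\<Prod>v\<in>A. w v ^ lkp m v)"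
  unfolding eval_monom_def
  by (rule prod.mono_neutral_left) (use assms in \<open>auto simp: in_keys_iff\<close>)

lemma eval_monom_add: "eval_monom w (m + m') = eval_monom w m * eval_monom w m'"
proof -
  let ?A = "Poly_Mapping.keys m \<union> Poly_Mapping.keys m'"
  have "eval_monom w (m + m') = (\<Prod>v\<in>?A. w v ^ lkp (m + m') v)"
    by (rule eval_monom_superset) (simp_all add: keys_add)
  also have "\<dots> = (\<Prod>v\<in>?A. w v ^ lkp m v) * (\<Prod>v\<in>?A. w v ^ lkp m' v)"
    by (simp add: lookup_add power_add prod.distrib)
  finally show ?thesis
    by (simp add: eval_monom_superset[symmetric])
qed

lemma poly_mapping_eq_sum_single: "(\<Sum>k\<in>Poly_Mapping.keys p. sgl k (lkp p k)) = p"
  by (rule poly_mapping_eqI)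
    (simp add: lookup_sum lookup_single when_def in_keys_iff)

text \<open>Distributivity over the decomposition of \<open>Q\<close> into terms; coefficients and
  values of such products are read off from this sum.\<close>

lemma single_times_eq_sum:
  fixes Q :: "'m::comm_monoid_add \<Rightarrow>\<^sub>0 'f::comm_ring_1"
  shows "sgl k c * Q = (\<Sum>m\<in>Poly_Mapping.keys Q. sgl (k + m) (c * lkp Q m))"
  by (subst poly_mapping_eq_sum_single[symmetric, of Q])
    (simp add: sum_distrib_left mult_single)

lemma lookup_single_times:
  fixes Q :: "'m::cancel_comm_monoid_add \<Rightarrow>\<^sub>0 'f::comm_ring_1"
  shows "lkp (sgl k c * Q) (k + x) = c * lkp Q x"
  by (simp add: single_times_eq_sum lookup_sum lookup_single when_def in_keys_iff)

lemma lookup_single_times_eq_0: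
  fixes Q :: "'m::comm_monoid_add \<Rightarrow>\<^sub>0 'f::comm_ring_1"
  assumes "\<And>y. x \<noteq> k + y"
  shows "lkp (sgl k c * Q) x = 0"
  by (simp add: single_times_eq_sum lookup_sum lookup_single when_def assms[symmetric])

lemma lookup_const_times:
  fixes Q :: "'m::cancel_comm_monoid_add \<Rightarrow>\<^sub>0 'f::comm_ring_1"
  shows "lkp (sgl 0 c * Q) x = c * lkp Q x"
  using lookup_single_times[of 0 c Q x] by simp

lemma keys_single_times:
  fixes Q :: "'m::comm_monoid_add \<Rightarrow>\<^sub>0 'f::comm_ring_1"
  shows "Poly_Mapping.keys (sgl k c * Q) \<subseteq> (+) k ` Poly_Mapping.keys Q"
  using keys_mult[of "sgl k c" Q] by (auto split: if_splits)

lemma exists_add_single: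
  fixes x :: "'v \<Rightarrow>\<^sub>0 nat"
  assumes "lkp x u \<noteq> 0"
  shows "\<exists>y. x = sgl u 1 + y"
proof
  show "x = sgl u 1 + (x - sgl u 1)"
    using assms by (intro poly_mapping_eqI) (auto simp: lookup_add lookup_minus lookup_single when_def)
qed

section \<open>Evaluation along a ring homomorphism\<close>

context comm_ring_hom
begin

lemma eval_mpoly_superset:
  assumes "finite A" "Poly_Mapping.keys P \<subseteq> A"
  shows "eval_mpoly hom w P = (\<Sum>m\<in>A. hom (lkp P m) * eval_monom w m)"
  unfolding eval_mpoly_def
  by (rule sum.mono_neutral_left) (use assms in \<open>auto simp: in_keys_iff\<close>)

lemma eval_mpoly_0 [simp]: "eval_mpoly hom w 0 = 0"
  by (simp add: eval_mpoly_def)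

lemma eval_mpoly_single [simp]: "eval_mpoly hom w (sgl m c) = hom c * eval_monom w m"
  by (simp add: eval_mpoly_def)

lemma eval_mpoly_1 [simp]: "eval_mpoly hom w 1 = 1"
  using eval_mpoly_single[of w 0 1] by simp

lemma eval_mpoly_add [simp]: "eval_mpoly hom w (P + Q) = eval_mpoly hom w P + eval_mpoly hom w Q"
proof -
  let ?A = "Poly_Mapping.keys P \<union> Poly_Mapping.keys Q"
  have "eval_mpoly hom w (P + Q) = (\<Sum>m\<in>?A. hom (lkp (P + Q) m) * eval_monom w m)"
    by (rule eval_mpoly_superset) (simp_all add: keys_add)
  also have "\<dots> = (\<Sum>m\<in>?A. hom (lkp P m) * eval_monom w m)
      + (\<Sum>m\<in>?A. hom (lkp Q m) * eval_monom w m)"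
    by (simp add: lookup_add hom_add distrib_right sum.distrib)
  finally show ?thesis
    by (simp add: eval_mpoly_superset[symmetric])
qed

lemma eval_mpoly_diff [simp]: "eval_mpoly hom w (P - Q) = eval_mpoly hom w P - eval_mpoly hom w Q"
  using eval_mpoly_add[of w "P - Q" Q] by simp

lemma eval_mpoly_sum: "eval_mpoly hom w (sum f A) = (\<Sum>x\<in>A. eval_mpoly hom w (f x))"
  by (induction A rule: infinite_finite_induct) auto

lemma eval_mpoly_single_times [simp]:
  "eval_mpoly hom w (sgl k c * Q) = hom c * eval_monom w k * eval_mpoly hom w Q"
proof -
  have "eval_mpoly hom w (sgl k c * Q)
      = (\<Sum>m\<in>Poly_Mapping.keys Q. hom c * hom (lkp Q m) * (eval_monom w k * eval_monom w m))"
    by (simp add: single_times_eq_sum eval_mpoly_sum hom_mult eval_monom_add)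
  also have "\<dots> = hom c * eval_monom w k * eval_mpoly hom w Q"
    by (simp add: eval_mpoly_def sum_distrib_left mult_ac)
  finally show ?thesis .
qed

end

section \<open>Algebraic relations between solutions of difference equations\<close>

text \<open>No derivation appears here: in the application \<open>W\<close> is a finite set of pairs
  \<open>(i, j)\<close>, and the derivatives of the \<open>z i\<close> are treated as unrelated
  unknowns.\<close>

locale difference_solutions =
  base: comm_ring_hom \<sigma> + ext: comm_ring_hom \<sigma>' + emb: inj_comm_ring_hom \<iota>
  for \<sigma> :: "'f::field_char_0 \<Rightarrow> 'f" and \<sigma>' :: "'s::comm_ring_1 \<Rightarrow> 's" and \<iota> :: "'f \<Rightarrow> 's" +
  fixes W :: "'v set" and w :: "'v \<Rightarrow> 's" and b :: "'v \<Rightarrow> 'f"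
  assumes sigma_ext: "\<sigma>' (\<iota> x) = \<iota> (\<sigma> x)"
    and finite_W: "finite W"
    and sigma_w: "v \<in> W \<Longrightarrow> \<sigma>' (w v) = w v + \<iota> (b v)"
begin

definition mpolys :: "(('v \<Rightarrow>\<^sub>0 nat) \<Rightarrow>\<^sub>0 'f) set"
  where "mpolys = {P. \<forall>m\<in>Poly_Mapping.keys P. Poly_Mapping.keys m \<subseteq> W}"

lemma mpolys_add: "P \<in> mpolys \<Longrightarrow> Q \<in> mpolys \<Longrightarrow> P + Q \<in> mpolys"
  using keys_add[of P Q] by (auto simp: mpolys_def)

lemma mpolys_diff: "P \<in> mpolys \<Longrightarrow> Q \<in> mpolys \<Longrightarrow> P - Q \<in> mpolys"
  using keys_diff[of P Q] by (auto simp: mpolys_def)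

lemma mpolys_sum: "(\<And>x. x \<in> A \<Longrightarrow> f x \<in> mpolys) \<Longrightarrow> sum f A \<in> mpolys"
  using keys_sum[of f A] by (fastforce simp: mpolys_def)

lemma mpolys_single_times:
  assumes "Q \<in> mpolys" "Poly_Mapping.keys k \<subseteq> W"
  shows "sgl k c * Q \<in> mpolys"
  unfolding mpolys_def
proof safe
  fix m v assume m: "m \<in> Poly_Mapping.keys (sgl k c * Q)" and v: "v \<in> Poly_Mapping.keys m"
  from m obtain m' where "m' \<in> Poly_Mapping.keys Q" "m = k + m'"
    using keys_single_times by blast
  with v assms show "v \<in> W"
    using keys_add[of k m'] by (auto simp: mpolys_def)
qed

section \<open>Substituting \<open>Y + b\<close> for \<open>Y\<close>\<close>

text \<open>
  \<open>Q\<close> is the monomial \<open>m\<close> with \<open>Y + b\<close> substituted for \<open>Y\<close>; only its two leading homogeneous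
  components \<open>m\<close> and \<open>\<Sum>\<^sub>v b\<^sub>v \<cdot> \<partial>m/\<partial>Y\<^sub>v\<close> matter.
\<close>

lemma ex_shifted_monomial:
  assumes "Poly_Mapping.keys m \<subseteq> W"
  shows "\<exists>Q\<in>mpolys. eval_mpoly \<iota> w Q = \<sigma>' (eval_monom w m) \<and>
    (\<forall>x. mdegree m \<le> mdegree x + 1 \<longrightarrow> lkp Q x = (1 when x = m) +
      (\<Sum>v\<in>W. of_nat (lkp m v) * b v when m = sgl v 1 + x))"
  using assms
proof (induction "mdegree m" arbitrary: m)
  case 0
  then have m: "m = 0" by simp
  show ?case
    by (rule bexI[of _ 1]) (auto simp: m mpolys_def lookup_one when_def)
next
  case (Suc d)
  from Suc(2) have "m \<noteq> 0" by auto
  then obtain u where u: "u \<in> Poly_Mapping.keys m" by (metis keys_eq_empty ex_in_conv)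
  then obtain m0 where m: "m = sgl u 1 + m0"
    using exists_add_single by (metis in_keys_iff)
  have "u \<in> W" using u Suc.prems by auto
  have "d = mdegree m0" using Suc(2) by (simp add: m)
  moreover have "Poly_Mapping.keys m0 \<subseteq> W"
    using Suc.prems by (auto simp: m in_keys_iff lookup_add)
  ultimately obtain Q where Q: "Q \<in> mpolys" "eval_mpoly \<iota> w Q = \<sigma>' (eval_monom w m0)"
    and lQ: "\<And>x. mdegree m0 \<le> mdegree x + 1 \<Longrightarrow> lkp Q x = (1 when x = m0) +
      (\<Sum>v\<in>W. of_nat (lkp m0 v) * b v when m0 = sgl v 1 + x)"
    using Suc(1) by blast
  \<comment> \<open>Substitution is multiplicative, so the polynomial for \<open>m\<close> is
    \<open>Y\<^sub>u + b\<^sub>u\<close> times the one for \<open>m0\<close>.\<close>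
  define Q' where "Q' = sgl (sgl u 1) 1 * Q + sgl 0 (b u) * Q"
  have "Q' \<in> mpolys"
    unfolding Q'_def using Q(1) \<open>u \<in> W\<close> by (intro mpolys_add mpolys_single_times) auto
  moreover have "eval_mpoly \<iota> w Q' = \<sigma>' (eval_monom w m)"
    by (simp only: Q'_def m emb.eval_mpoly_add emb.eval_mpoly_single_times Q(2) eval_monom_add
        eval_monom_single eval_monom_0 ext.hom_mult sigma_w[OF \<open>u \<in> W\<close>] emb.hom_one)
      (simp add: algebra_simps)
  moreover have "lkp Q' x = (1 when x = m) +
      (\<Sum>v\<in>W. of_nat (lkp m v) * b v when m = sgl v 1 + x)"
    if deg: "mdegree m \<le> mdegree x + 1" for x
  proof -
    \<comment> \<open>Here \<open>x\<close> has at least the degree of \<open>m0\<close>, so the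
      summand with factor \<open>b u\<close> contributes only through the monomial \<open>m0\<close>
      itself.\<close>
    have "m0 \<noteq> sgl v 1 + x" for v
      using deg by (auto simp: m)
    then have c: "lkp (sgl 0 (b u) * Q) x = (b u when x = m0)"
      using deg by (simp add: lookup_const_times lQ m when_def)
    \<comment> \<open>Product rule: passing from \<open>m0\<close> to \<open>m\<close> raises only
      the exponent of \<open>u\<close>, and the extra \<open>b u\<close> appears exactly at
      \<open>x = m0\<close>.\<close>
    have "(\<Sum>v\<in>W. of_nat (lkp m v) * b v when m = sgl v 1 + x)
        = (\<Sum>v\<in>W. (of_nat (lkp m0 v) * b v when m = sgl v 1 + x)
            + (if v = u then b u when x = m0 else 0))"
    proof (rule sum.cong)
      fix v
      show "(of_nat (lkp m v) * b v when m = sgl v 1 + x)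
          = (of_nat (lkp m0 v) * b v when m = sgl v 1 + x) + (if v = u then b u when x = m0 else 0)"
      proof (cases "m = sgl v 1 + x")
        case True
        have "lkp m v = (1 when u = v) + lkp m0 v"
          by (simp add: m lookup_add lookup_single)
        moreover have "x = m0" if "v = u"
          using True that by (simp add: m)
        ultimately show ?thesis
          using True by (auto simp: when_def distrib_right)
      next
        case False
        then show ?thesis by (auto simp: m)
      qed
    qed simp
    also have "\<dots> = (\<Sum>v\<in>W. of_nat (lkp m0 v) * b v when m = sgl v 1 + x) + (b u when x = m0)"
      using finite_W \<open>u \<in> W\<close> by (simp add: sum.distrib)
    finally have rhs: "(\<Sum>v\<in>W. of_nat (lkp m v) * b v when m = sgl v 1 + x) = \<dots>" .
    have "lkp (sgl (sgl u 1) 1 * Q) x = (1 when x = m) +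
        (\<Sum>v\<in>W. of_nat (lkp m0 v) * b v when m = sgl v 1 + x)"
    proof (cases "lkp x u = 0")
      case False
      then obtain y where y: "x = sgl u 1 + y" using exists_add_single[OF False] by blast
      have "lkp (sgl (sgl u 1) 1 * Q) x = lkp Q y"
        unfolding y by (simp only: lookup_single_times) simp
      also have "\<dots> = (1 when y = m0) +
          (\<Sum>v\<in>W. of_nat (lkp m0 v) * b v when m0 = sgl v 1 + y)"
        using deg by (intro lQ) (simp add: m y)
      also have "(y = m0) = (x = m)"
        by (simp add: y m)
      also have "(\<lambda>v. m0 = sgl v 1 + y) = (\<lambda>v. m = sgl v 1 + x)"
        unfolding y m by (rule ext) (metis add.left_commute add_left_cancel)
      finally show ?thesis .
    next
      case True
      have "x \<noteq> sgl u 1 + y" for y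
        using True by (auto simp: lookup_add)
      then have "lkp (sgl (sgl u 1) 1 * Q) x = 0" "x \<noteq> m"
        by (auto intro: lookup_single_times_eq_0 simp: m)
      \<comment> \<open>If \<open>Y\<^sub>u\<close> does not divide \<open>x\<close>, then
        \<open>m = sgl v 1 + x\<close> forces \<open>v = u\<close> and leaves no \<open>u\<close> in
        \<open>m0\<close>, so the derivative factor is zero.\<close>
      moreover have "(of_nat (lkp m0 v) * b v when m = sgl v 1 + x) = 0" for v
      proof (cases "m = sgl v 1 + x")
        case eq: True
        have "lkp (sgl u 1 + m0) u = lkp (sgl v 1 + x) u"
          using eq by (simp add: m)
        then have "v = u" "lkp m0 u = 0"
          using True by (auto simp: lookup_add lookup_single when_def split: if_splits)
        then show ?thesis by simp
      qed simp
      ultimately show ?thesis by simp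
    qed
    then show ?thesis
      unfolding rhs by (simp add: Q'_def lookup_add c)
  qed
  ultimately show ?case by blast
qed

text \<open>A choice of one such polynomial. Coefficients in degrees below
  \<open>mdegree m - 1\<close> stay unspecified; they are controlled only through the value at
  \<open>w\<close>.\<close>

definition shift_monom :: "('v \<Rightarrow>\<^sub>0 nat) \<Rightarrow> (('v \<Rightarrow>\<^sub>0 nat) \<Rightarrow>\<^sub>0 'f)"
  where "shift_monom m = (SOME Q. Q \<in> mpolys \<and> eval_mpoly \<iota> w Q = \<sigma>' (eval_monom w m) \<and>
    (\<forall>x. mdegree m \<le> mdegree x + 1 \<longrightarrow> lkp Q x = (1 when x = m) +
      (\<Sum>v\<in>W. of_nat (lkp m v) * b v when m = sgl v 1 + x)))"

lemma shift_monom: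
  assumes "Poly_Mapping.keys m \<subseteq> W"
  shows "shift_monom m \<in> mpolys"
    and "eval_mpoly \<iota> w (shift_monom m) = \<sigma>' (eval_monom w m)"
    and "mdegree m \<le> mdegree x + 1 \<Longrightarrow> lkp (shift_monom m) x = (1 when x = m) +
      (\<Sum>v\<in>W. of_nat (lkp m v) * b v when m = sgl v 1 + x)"
  using someI_ex[OF ex_shifted_monomial[OF assms, unfolded Bex_def]]
  unfolding shift_monom_def[symmetric] by auto

text \<open>Plays the part of \<open>P\<^sup>\<sigma>(Y + b)\<close>: \<open>\<sigma>\<close> acts
  on the coefficients and every monomial is replaced by its substituted form.\<close>

definition shift :: "(('v \<Rightarrow>\<^sub>0 nat) \<Rightarrow>\<^sub>0 'f) \<Rightarrow> (('v \<Rightarrow>\<^sub>0 nat) \<Rightarrow>\<^sub>0 'f)"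
  where "shift P = (\<Sum>m\<in>Poly_Mapping.keys P. sgl 0 (\<sigma> (lkp P m)) * shift_monom m)"

lemma shift_in_mpolys: "P \<in> mpolys \<Longrightarrow> shift P \<in> mpolys"
  unfolding shift_def by (intro mpolys_sum mpolys_single_times shift_monom) (auto simp: mpolys_def)

text \<open>Holds because \<open>\<sigma>'\<close> is a ring homomorphism extending
  \<open>\<sigma>\<close>. Since \<open>\<sigma>' 0 = 0\<close>, the shift of a relation is again a
  relation.\<close>

lemma eval_shift:
  assumes "P \<in> mpolys"
  shows "eval_mpoly \<iota> w (shift P) = \<sigma>' (eval_mpoly \<iota> w P)"
proof -
  have "eval_mpoly \<iota> w (shift P)
      = (\<Sum>m\<in>Poly_Mapping.keys P. \<iota> (\<sigma> (lkp P m)) * \<sigma>' (eval_monom w m))"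
    unfolding shift_def emb.eval_mpoly_sum
    by (rule sum.cong) (use assms in \<open>auto simp: mpolys_def shift_monom(2)\<close>)
  also have "\<dots> = \<sigma>' (eval_mpoly \<iota> w P)"
    by (simp add: eval_mpoly_def ext.hom_sum ext.hom_mult sigma_ext)
  finally show ?thesis .
qed

text \<open>First-order Taylor expansion: under the degree bound only \<open>x\<close> and the
  monomials \<open>sgl v 1 + x\<close> contribute. The factor \<open>lkp x v + 1\<close> is the
  exponent of \<open>v\<close> in the latter.\<close>

lemma lookup_shift:
  assumes "P \<in> mpolys" and "\<And>m. m \<in> Poly_Mapping.keys P \<Longrightarrow> mdegree m \<le> mdegree x + 1"
  shows "lkp (shift P) x = \<sigma> (lkp P x) +
    (\<Sum>v\<in>W. b v * (of_nat (lkp x v + 1) * \<sigma> (lkp P (sgl v 1 + x))))"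
proof -
  let ?K = "Poly_Mapping.keys P"
  have "lkp (shift P) x = (\<Sum>m\<in>?K. \<sigma> (lkp P m) * lkp (shift_monom m) x)"
    by (simp add: shift_def lookup_sum lookup_const_times)
  also have "\<dots> = (\<Sum>m\<in>?K. \<sigma> (lkp P m) * ((1 when x = m) +
      (\<Sum>v\<in>W. of_nat (lkp m v) * b v when m = sgl v 1 + x)))"
    by (rule sum.cong) (use assms in \<open>auto simp: mpolys_def shift_monom(3)\<close>)
  also have "\<dots> = (\<Sum>m\<in>?K. \<sigma> (lkp P m) when x = m) +
      (\<Sum>m\<in>?K. \<Sum>v\<in>W. \<sigma> (lkp P m) * (of_nat (lkp m v) * b v) when m = sgl v 1 + x)"
    by (simp only: distrib_left sum.distrib sum_distrib_left mult_when mult_1_right)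
  also have "(\<Sum>m\<in>?K. \<sigma> (lkp P m) when x = m) = \<sigma> (lkp P x)"
    by (simp add: when_def in_keys_iff)
  also have "(\<Sum>m\<in>?K. \<Sum>v\<in>W. \<sigma> (lkp P m) * (of_nat (lkp m v) * b v) when m = sgl v 1 + x)
      = (\<Sum>v\<in>W. \<Sum>m\<in>?K. \<sigma> (lkp P m) * (of_nat (lkp m v) * b v) when m = sgl v 1 + x)"
    by (rule sum.swap)
  also have "\<dots> = (\<Sum>v\<in>W. b v * (of_nat (lkp x v + 1) * \<sigma> (lkp P (sgl v 1 + x))))"
  proof (rule sum.cong)
    fix v
    show "(\<Sum>m\<in>?K. \<sigma> (lkp P m) * (of_nat (lkp m v) * b v) when m = sgl v 1 + x)
        = b v * (of_nat (lkp x v + 1) * \<sigma> (lkp P (sgl v 1 + x)))"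
      using sum.delta[of ?K "sgl v 1 + x" "\<lambda>m. \<sigma> (lkp P m) * (of_nat (lkp m v) * b v)"]
      by (auto simp: when_def in_keys_iff lookup_add mult_ac)
  qed simp
  finally show ?thesis .
qed

text \<open>No monomial of \<open>P\<close> has degree above that of \<open>x\<close>, so all
  first-order corrections vanish.\<close>

lemma lookup_shift_top:
  assumes "P \<in> mpolys" and "\<And>m. m \<in> Poly_Mapping.keys P \<Longrightarrow> mdegree m \<le> mdegree x"
  shows "lkp (shift P) x = \<sigma> (lkp P x)"
proof -
  have "lkp P (sgl v 1 + x) = 0" for v
    using assms(2)[of "sgl v 1 + x"] by (auto simp: in_keys_iff)
  then show ?thesis
    using assms by (subst lookup_shift) (auto intro: le_SucI)
qed

section \<open>Descent on the leading monomials of a relation\<close>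

definition leading_monoms :: "(('v \<Rightarrow>\<^sub>0 nat) \<Rightarrow>\<^sub>0 'f) \<Rightarrow> ('v \<Rightarrow>\<^sub>0 nat) set"
  where "leading_monoms P =
    {m\<in>Poly_Mapping.keys P. \<forall>m'\<in>Poly_Mapping.keys P. mdegree m' \<le> mdegree m}"

lemma leading_monoms_nonempty:
  assumes "P \<noteq> 0"
  shows "leading_monoms P \<noteq> {}"
proof -
  have "Max (mdegree ` Poly_Mapping.keys P) \<in> mdegree ` Poly_Mapping.keys P"
    using assms by (intro Max_in) auto
  then obtain m where m: "m \<in> Poly_Mapping.keys P"
    and max: "mdegree m = Max (mdegree ` Poly_Mapping.keys P)"
    by (metis imageE)
  have "m \<in> leading_monoms P"
    by (simp add: leading_monoms_def m max)
  then show ?thesis by blast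
qed

theorem relation_imp_telescoping:
  assumes "P \<in> mpolys" "P \<noteq> 0" "eval_mpoly \<iota> w P = 0"
  shows "\<exists>c f. (\<forall>v\<in>W. \<sigma> (c v) = c v) \<and> (\<exists>v\<in>W. c v \<noteq> 0) \<and> (\<Sum>v\<in>W. c v * b v) = \<sigma> f - f"
  using assms
\<comment> \<open>Minimality takes the form of well-founded induction on the degree and then the
  number of monomials of that degree, ordered lexicographically.\<close>
proof (induction P rule: wf_induct_rule[OF wf_measures[of
        "[\<lambda>P. Max (mdegree ` Poly_Mapping.keys P), \<lambda>P. card (leading_monoms P)]"]])
  case (1 P0)
  obtain m0 where m0: "m0 \<in> leading_monoms P0"
    using leading_monoms_nonempty[OF \<open>P0 \<noteq> 0\<close>] by blast
  \<comment> \<open>Normalising the coefficient at \<open>m0\<close> to \<open>1\<close> keeps the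
    set of monomials, hence the measure, and makes \<open>m0\<close> cancel in
    \<open>shift P - P\<close>.\<close>
  define P where "P = sgl 0 (inverse (lkp P0 m0)) * P0"
  have c0: "lkp P0 m0 \<noteq> 0"
    using m0 by (auto simp: leading_monoms_def in_keys_iff)
  have lP: "lkp P x = inverse (lkp P0 m0) * lkp P0 x" for x
    by (simp add: P_def lookup_const_times)
  have keysP: "Poly_Mapping.keys P = Poly_Mapping.keys P0"
    using c0 by (auto simp: in_keys_iff lP)
  have P: "P \<in> mpolys" "eval_mpoly \<iota> w P = 0"
    using 1 by (auto simp: P_def intro: mpolys_single_times)
  have P1: "lkp P m0 = 1"
    using c0 by (simp add: lP)
  have m0K: "m0 \<in> Poly_Mapping.keys P"
    and m0_max: "\<And>m. m \<in> Poly_Mapping.keys P \<Longrightarrow> mdegree m \<le> mdegree m0"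
    using m0 by (auto simp: leading_monoms_def keysP)
  have maxP0: "Max (mdegree ` Poly_Mapping.keys P0) = mdegree m0"
    using m0 by (auto simp: leading_monoms_def intro!: Max_eqI)
  define R where "R = shift P - P"
  have R: "R \<in> mpolys" "eval_mpoly \<iota> w R = 0"
    using P by (auto simp: R_def eval_shift intro: mpolys_diff shift_in_mpolys)
  have R_top: "lkp R x = \<sigma> (lkp P x) - lkp P x" if "mdegree m0 \<le> mdegree x" for x
    by (simp add: R_def lookup_minus lookup_shift_top[OF P(1) order_trans[OF m0_max that]])
  show ?case
  proof (cases "R = 0")
    case False
    have deg_R: "mdegree x \<le> mdegree m0" if "x \<in> Poly_Mapping.keys R" for x
    proof (rule ccontr)
      assume *: "\<not> ?thesis"
      then have "lkp P x = 0"
        using m0_max[of x] by (auto simp: in_keys_iff)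
      then show False
        using that R_top[of x] * by (simp add: in_keys_iff)
    qed
    have "R \<noteq> 0" by fact
    have "Max (mdegree ` Poly_Mapping.keys R) \<le> mdegree m0"
      using deg_R \<open>R \<noteq> 0\<close> by auto
    \<comment> \<open>If the degree does not drop, every leading monomial of \<open>R\<close> is
      already one of \<open>P0\<close>, while \<open>m0\<close> has been lost.\<close>
    moreover have "card (leading_monoms R) < card (leading_monoms P0)"
      if eq: "Max (mdegree ` Poly_Mapping.keys R) = mdegree m0"
    proof (rule psubset_card_mono)
      show "finite (leading_monoms P0)" by (simp add: leading_monoms_def)
      have deg: "mdegree x = mdegree m0" if "x \<in> leading_monoms R" for x
        unfolding eq[symmetric] using that by (auto simp: leading_monoms_def intro!: Max_eqI[symmetric])
      have "m0 \<notin> leading_monoms R"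
        using R_top[of m0] P1 by (auto simp: leading_monoms_def in_keys_iff)
      moreover have "x \<in> leading_monoms P0" if x: "x \<in> leading_monoms R" for x
      proof -
        have "lkp R x \<noteq> 0" using x by (auto simp: leading_monoms_def in_keys_iff)
        then have "x \<in> Poly_Mapping.keys P"
          using R_top[of x] deg[OF x] by (auto simp: in_keys_iff)
        then show ?thesis
          using m0_max deg[OF x] by (auto simp: leading_monoms_def keysP)
      qed
      ultimately show "leading_monoms R \<subset> leading_monoms P0"
        using m0 by blast
    qed
    ultimately have "(R, P0) \<in> measures [\<lambda>P. Max (mdegree ` Poly_Mapping.keys P),
        \<lambda>P. card (leading_monoms P)]"
      by (auto simp: maxP0)
    then show ?thesis
      using 1(1) R \<open>R \<noteq> 0\<close> by blast
  next
    case True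
    \<comment> \<open>Otherwise \<open>P\<close> would be the constant \<open>1\<close>, whose value
      is not zero.\<close>
    have "m0 \<noteq> 0"
    proof
      assume "m0 = 0"
      then have "Poly_Mapping.keys P = {0}"
        using m0K m0_max by auto
      then have "eval_mpoly \<iota> w P = 1"
        using P1 \<open>m0 = 0\<close> by (simp add: eval_mpoly_def)
      with P(2) have "\<iota> 1 = \<iota> 0" by simp
      then show False
        by (metis emb.injectivity zero_neq_one)
    qed
    then obtain u where u: "u \<in> Poly_Mapping.keys m0" by (metis keys_eq_empty ex_in_conv)
    then obtain x where x: "m0 = sgl u 1 + x"
      using exists_add_single by (metis in_keys_iff)
    have "u \<in> W" using u m0K P(1) by (auto simp: mpolys_def)
    \<comment> \<open>The coefficient of \<open>x\<close> in the partial derivative of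
      \<open>P\<close> by \<open>Y\<^sub>v\<close>, where \<open>x\<close> is \<open>m0\<close> with
      one factor \<open>Y\<^sub>u\<close> removed.\<close>
    define c where "c v = of_nat (lkp x v + 1) * lkp P (sgl v 1 + x)" for v
    \<comment> \<open>These monomials have the degree of \<open>m0\<close>, where
      \<open>R = 0\<close> says that \<open>\<sigma>\<close> fixes the coefficient.\<close>
    have inv: "\<sigma> (lkp P (sgl v 1 + x)) = lkp P (sgl v 1 + x)" for v
      using R_top[of "sgl v 1 + x"] True by (simp add: x)
    have "\<sigma> (c v) = c v" for v
      unfolding c_def by (simp only: base.hom_mult base.hom_of_nat inv)
    \<comment> \<open>Since \<open>m0\<close> has coefficient \<open>1\<close>, \<open>c u\<close>
      is the positive integer \<open>lkp x u + 1\<close>, nonzero in characteristic zero.\<close>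
    moreover have "c u \<noteq> 0"
      using P1 unfolding c_def x[symmetric] by (metis of_nat_eq_0_iff mult.right_neutral add_is_0 one_neq_zero)
    moreover have "(\<Sum>v\<in>W. c v * b v) = \<sigma> (- lkp P x) - (- lkp P x)"
    proof -
      have "lkp (shift P) x = lkp P x"
        using True by (simp add: R_def)
      moreover have "lkp (shift P) x = \<sigma> (lkp P x) + (\<Sum>v\<in>W. b v * c v)"
      proof -
        have "mdegree m \<le> mdegree x + 1" if "m \<in> Poly_Mapping.keys P" for m
          using m0_max[OF that] by (simp add: x)
        from lookup_shift[OF P(1) this] show ?thesis
          unfolding inv c_def .
      qed
      ultimately have "(\<Sum>v\<in>W. b v * c v) = lkp P x - \<sigma> (lkp P x)"
        by (simp add: algebra_simps)
      then show ?thesis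
        by (simp add: base.hom_uminus mult.commute)
    qed
    ultimately show ?thesis
      using \<open>u \<in> W\<close> by blast
  qed
qed

end


section \<open>Differential polynomials\<close>

lemma (in derivation) funpow_D_add: "(D ^^ j) (x + y) = (D ^^ j) x + (D ^^ j) y"
  by (induction j) (auto simp: D_add)

lemma (in sigma_delta_ring) sigma_funpow_delta: "\<sigma> ((\<delta> ^^ j) x) = (\<delta> ^^ j) (\<sigma> x)"
  by (induction j) (auto simp: commute)

lemma (in sigma_delta_extension) funpow_delta_extends: "(\<delta>' ^^ j) (\<iota> x) = \<iota> ((\<delta> ^^ j) x)"
  by (induction j) (auto simp: delta_extends)

lemma eval_dpoly_eq_eval_mpoly:
  "eval_dpoly h D z P = eval_mpoly h (\<lambda>(i, j). (D ^^ j) (z i)) P"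
  unfolding eval_dpoly_def eval_mpoly_def eval_monom_def
  by (intro sum.cong prod.cong arg_cong2[of _ _ _ _ "(*)"]) auto

definition linear_dpoly :: "nat \<Rightarrow> nat \<Rightarrow> (nat \<Rightarrow> nat \<Rightarrow> 'a) \<Rightarrow> 'a::comm_ring_1 dpoly"
  where "linear_dpoly n r c = (\<Sum>i=1..n. \<Sum>j\<le>r. sgl (dvar i j) (c i j))"

lemma dvar_eq_iff: "dvar i j = dvar i' j' \<longleftrightarrow> i = i' \<and> j = j'"
proof
  assume "dvar i j = dvar i' j'"
  then have "Poly_Mapping.keys (dvar i j) = Poly_Mapping.keys (dvar i' j')" by simp
  then show "i = i' \<and> j = j'" by (simp add: dvar_def)
qed simp

text \<open>Distinct pairs give distinct indeterminates, so no terms merge; both directions use this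
  to see that a polynomial is nonzero.\<close>

lemma lookup_linear_dpoly:
  assumes "i \<in> {1..n}" "j \<le> r"
  shows "lkp (linear_dpoly n r c) (dvar i j) = c i j"
proof -
  have "lkp (linear_dpoly n r c) (dvar i j)
      = (\<Sum>i'=1..n. \<Sum>j'\<le>r. if i' = i then if j' = j then c i' j' else 0 else 0)"
    by (simp add: linear_dpoly_def lookup_sum lookup_single when_def dvar_eq_iff
        if_if_eq_conj)
  also have "\<dots> = (\<Sum>i'=1..n. if i' = i then c i j else 0)"
    by (rule sum.cong) (use assms in auto)
  also have "\<dots> = c i j"
    using assms by simp
  finally show ?thesis .
qed

lemma linear_dpoly_eq_0: "(\<And>i j. i \<in> {1..n} \<Longrightarrow> j \<le> r \<Longrightarrow> c i j = 0) \<Longrightarrow> linear_dpoly n r c = 0"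
  by (simp add: linear_dpoly_def)

lemma dpolys_add: "P \<in> dpolys n \<Longrightarrow> Q \<in> dpolys n \<Longrightarrow> P + Q \<in> dpolys n"
  using keys_add[of P Q] by (auto simp: dpolys_def)

lemma dpolys_sum: "(\<And>x. x \<in> A \<Longrightarrow> f x \<in> dpolys n) \<Longrightarrow> sum f A \<in> dpolys n"
  using keys_sum[of f A] by (fastforce simp: dpolys_def)

lemma linear_dpoly_in_dpolys: "linear_dpoly n r c \<in> dpolys n"
  unfolding linear_dpoly_def
  by (intro dpolys_sum) (auto simp: dpolys_def dvar_def)

lemma (in comm_ring_hom) eval_linear_dpoly:
  "eval_dpoly hom D z (linear_dpoly n r c) = (\<Sum>i=1..n. \<Sum>j\<le>r. hom (c i j) * (D ^^ j) (z i))"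
proof -
  have "eval_monom (\<lambda>(i, j). (D ^^ j) (z i)) (dvar i j) = (D ^^ j) (z i)" for i j
    unfolding dvar_def by (simp only: eval_monom_single prod.case)
  then show ?thesis
    by (simp add: eval_dpoly_eq_eval_mpoly linear_dpoly_def eval_mpoly_sum)
qed

section \<open>The equivalence for differential relations\<close>

theorem mainTheorem6:
  fixes \<sigma> \<delta> :: "'f::field_char_0 \<Rightarrow> 'f"
    and \<sigma>' \<delta>' :: "'s::comm_ring_1 \<Rightarrow> 's"
    and \<iota> :: "'f \<Rightarrow> 's"
    and n :: nat
    and a :: "nat \<Rightarrow> 'f"
    and z :: "nat \<Rightarrow> 's"
  assumes "sigma_delta_ring \<sigma> \<delta>"
    and "bij \<sigma>"
    and "algebraically_closed_subfield (invariants \<sigma>)"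
    and "sigma_delta_extension \<sigma> \<delta> \<sigma>' \<delta>' \<iota>"
    and "invariants \<sigma>' = \<iota> ` invariants \<sigma>"
    and "\<And>i. i \<in> {1..n} \<Longrightarrow> \<sigma>' (z i) - z i = \<iota> (a i)"
  shows "satisfies_nontrivial_relation \<iota> \<delta>' n z \<longleftrightarrow>
    (\<exists>L\<in>homogeneous_linear_dpolys n (invariants \<sigma>). L \<noteq> 0 \<and>
      (\<exists>f. eval_dpoly id \<delta> a L = \<sigma> f - f))"
proof -
  interpret sigma_delta_extension \<sigma> \<delta> \<sigma>' \<delta>' \<iota> by fact
  interpret ident: comm_ring_hom "id :: 'f \<Rightarrow> 'f" by unfold_locales auto
  \<comment> \<open>As \<open>\<sigma>'\<close> commutes with \<open>\<delta>'\<close>, applying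
    \<open>\<delta>'\<close> repeatedly to the given equations turns derivatives of
    \<open>z i\<close> into solutions of difference equations too.\<close>
  have sigma_z: "\<sigma>' ((\<delta>' ^^ j) (z i)) = (\<delta>' ^^ j) (z i) + \<iota> ((\<delta> ^^ j) (a i))"
    if "i \<in> {1..n}" for i j
  proof -
    have "\<sigma>' (z i) = z i + \<iota> (a i)"
      using assms(6)[OF that] by (simp add: algebra_simps)
    then show ?thesis
      by (simp add: ext.sigma_funpow_delta ext.funpow_D_add funpow_delta_extends)
  qed
  show ?thesis
  proof
    assume "satisfies_nontrivial_relation \<iota> \<delta>' n z"
    then obtain P where P: "P \<in> dpolys n" "P \<noteq> 0" "eval_dpoly \<iota> \<delta>' z P = 0"
      by (auto simp: satisfies_nontrivial_relation_def)
    define V where "V = (\<Union>m\<in>Poly_Mapping.keys P. Poly_Mapping.keys m)"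
    have "finite V" by (simp add: V_def)
    \<comment> \<open>A bound for the orders of the derivatives in \<open>P\<close>; inserting
      \<open>0\<close> keeps the maximum defined when \<open>P\<close> is constant.\<close>
    define r where "r = Max (insert 0 (snd ` V))"
    have r: "j \<le> r" if "(i, j) \<in> V" for i j
      unfolding r_def using that \<open>finite V\<close> by (intro Max_ge) force+
    interpret difference_solutions \<sigma> \<sigma>' \<iota> "{1..n} \<times> {..r}"
      "\<lambda>(i, j). (\<delta>' ^^ j) (z i)" "\<lambda>(i, j). (\<delta> ^^ j) (a i)"
      by unfold_locales (auto simp: sigma_extends sigma_z)
    have "V \<subseteq> {1..n} \<times> {..r}"
      using P(1) r by (force simp: V_def dpolys_def)
    then have "P \<in> mpolys"
      by (simp only: mpolys_def V_def UN_subset_iff mem_Collect_eq)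
    from relation_imp_telescoping[OF this P(2) P(3)[unfolded eval_dpoly_eq_eval_mpoly]]
    obtain c f where c: "\<forall>v\<in>{1..n} \<times> {..r}. \<sigma> (c v) = c v"
      and nz: "\<exists>v\<in>{1..n} \<times> {..r}. c v \<noteq> 0"
      and f: "(\<Sum>v\<in>{1..n} \<times> {..r}. c v * (case v of (i, j) \<Rightarrow> (\<delta> ^^ j) (a i))) = \<sigma> f - f"
      by (elim exE conjE) (rule that)
    let ?L = "linear_dpoly n r (\<lambda>i j. c (i, j))"
    have "?L \<in> homogeneous_linear_dpolys n (invariants \<sigma>)"
      unfolding homogeneous_linear_dpolys_def linear_dpoly_def
      using c by (auto simp: invariants_def intro!: exI[of _ r] exI[of _ "\<lambda>i j. c (i, j)"])
    moreover have "?L \<noteq> 0"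
    proof -
      obtain i j where "i \<in> {1..n}" "j \<le> r" "c (i, j) \<noteq> 0" using nz by auto
      then show ?thesis
        using lookup_linear_dpoly[of i n j r "\<lambda>i j. c (i, j)"] by auto
    qed
    moreover have "eval_dpoly id \<delta> a ?L = \<sigma> f - f"
      unfolding ident.eval_linear_dpoly f[symmetric]
      by (simp add: sum.cartesian_product split_def)
    ultimately show "\<exists>L\<in>homogeneous_linear_dpolys n (invariants \<sigma>). L \<noteq> 0 \<and>
        (\<exists>f. eval_dpoly id \<delta> a L = \<sigma> f - f)"
      by blast
  next
    assume "\<exists>L\<in>homogeneous_linear_dpolys n (invariants \<sigma>). L \<noteq> 0 \<and>
        (\<exists>f. eval_dpoly id \<delta> a L = \<sigma> f - f)"
    then obtain r c f where c: "\<And>i j. i \<in> {1..n} \<Longrightarrow> j \<le> r \<Longrightarrow> \<sigma> (c i j) = c i j"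
      and nz: "linear_dpoly n r c \<noteq> 0"
      and f: "eval_dpoly id \<delta> a (linear_dpoly n r c) = \<sigma> f - f"
      unfolding homogeneous_linear_dpolys_def invariants_def linear_dpoly_def by blast
    let ?L = "linear_dpoly n r c"
    let ?x = "eval_dpoly \<iota> \<delta>' z ?L"
    \<comment> \<open>The coefficients of \<open>L\<close> are invariant, so
      \<open>\<sigma>'\<close> changes \<open>L(z)\<close> exactly by \<open>L(a)\<close>.\<close>
    have "\<sigma>' ?x = (\<Sum>i=1..n. \<Sum>j\<le>r. \<iota> (c i j) * ((\<delta>' ^^ j) (z i) + \<iota> ((\<delta> ^^ j) (a i))))"
      unfolding eval_linear_dpoly ext.hom_sum
      by (intro sum.cong) (simp_all add: ext.hom_mult sigma_extends c sigma_z)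
    also have "\<dots> = ?x + \<iota> (eval_dpoly id \<delta> a ?L)"
      by (simp add: eval_linear_dpoly ident.eval_linear_dpoly hom_sum hom_mult distrib_left sum.distrib)
    finally have "\<sigma>' (?x - \<iota> f) = ?x - \<iota> f"
      by (simp add: f ext.hom_minus sigma_extends hom_minus)
    then have "?x - \<iota> f \<in> \<iota> ` invariants \<sigma>"
      unfolding assms(5)[symmetric] by (simp add: invariants_def)
    then obtain k where k: "?x = \<iota> (f + k)"
      by (auto simp: hom_add algebra_simps)
    \<comment> \<open>The relation is \<open>L(Y) - (f + k)\<close>; its constant term lies in
      degree zero and so cannot cancel a coefficient of \<open>L\<close>.\<close>
    define P where "P = ?L + sgl 0 (- (f + k))"
    have "P \<in> dpolys n"
      unfolding P_def by (intro dpolys_add linear_dpoly_in_dpolys) (simp add: dpolys_def)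
    moreover have "P \<noteq> 0"
    proof -
      obtain i j where ij: "i \<in> {1..n}" "j \<le> r" "c i j \<noteq> 0"
        using nz linear_dpoly_eq_0 by metis
      have "dvar i j \<noteq> 0"
        by (metis dvar_def lookup_single_eq lookup_zero one_neq_zero)
      then have "lkp P (dvar i j) = c i j"
        using ij by (simp add: P_def lookup_add lookup_single when_def lookup_linear_dpoly)
      with ij show ?thesis by auto
    qed
    moreover have "eval_dpoly \<iota> \<delta>' z P = 0"
      using k by (simp add: P_def eval_dpoly_eq_eval_mpoly hom_add hom_minus hom_uminus)
    ultimately show "satisfies_nontrivial_relation \<iota> \<delta>' n z"
      by (auto simp: satisfies_nontrivial_relation_def)
  qed
qed

end
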